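(* Let $m$ be a positive integer, let $\mu\subseteq\lambda$ be partitions with $\ell(\lambda)\le m$, and suppose $|\lambda/\mu|=n$ where $n$ is odd. Suppose that $\gcd(m,p)=1$ for every odd prime $p$ with $p\le n$. Let $G=\langle g\rangle$ be a cyclic group of order $2m$ acting on the set $SP(\lambda/\mu,2m)$ of Kashiwara–Nakashima skew symplectic tableaux with the property that, for every $T\in SP(\lambda/\mu,2m)$ with $\mathrm{wt}(T)=(\chi_1,\ldots,\chi_m)$, one has $\mathrm{wt}(gT)=(-\chi_m,\chi_1,\ldots,\chi_{m-1})$. Then every orbit in $SP(\lambda/\mu,2m)$ under the action of $G$ has cardinality $2m$.
   Context: A partition $\lambda=(\lambda_1\ge\lambda_2\ge\cdots)$ has length $\ell(\lambda)$ (number of nonzero parts) and size $|\lambda|=\sum\lambda_i$. Write $\mu\subseteq\lambda$ if $\mu_i\le\lambda_i$ for all $i$ ($\mu=\emptyset$ allowed); $\lambda/\mu$ is the skew shape obtained by removing the boxes of the Young diagram of $\mu$ from that of $\lambda$ (English convention, left-justified rows), and $|\lambda/\mu|=|\lambda|-|\mu|$. Alphabet: $\mathcal M=\{1<2<\cdots<m<\overline m<\cdots<\overline 2<\overline 1\}$. A filling of a skew shape with letters of $\mathcal M$ is semistandard if entries weakly increase along rows from left to right and strictly increase down columns. Admissible columns and splitting: a column $C$ is a strictly increasing (top to bottom) sequence of letters of $\mathcal M$. Let $z_1>\cdots>z_r$ be the unbarred letters $z$ such that both $z$ and $\overline z$ occur in $C$. $C$ is admissible if there exist unbarred letters $t_1>\cdots>t_r$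 in $\{1,\ldots,m\}$ such that $t_1$ is the greatest unbarred letter with $t_1<z_1$ and $t_1,\overline{t_1}\notin C$, and for $i=2,\ldots,r$, $t_i$ is the greatest unbarred letter with $t_i<\min(t_{i-1},z_i)$ and $t_i,\overline{t_i}\notin C$. In that case $rC$ is the column obtained from $C$ by replacing each $\overline{z_i}$ by $\overline{t_i}$ and reordering increasingly, and $\ell C$ is the column obtained from $C$ by replacing each $z_i$ by $t_i$ and reordering increasingly. A Kashiwara–Nakashima (KN) skew symplectic tableau of shape $\lambda/\mu$ is a semistandard filling $T$ of $\lambda/\mu$ with letters of $\mathcal M$, all of whose columns are admissible, such that the split form (the filling with twice as many columns obtained by replacing each column $C$ of $T$ by the two adjacent columns $\ell C, rC$, placed in the same rows) is again semistandard. $SP(\lambda/\mu,2m)$ denotes the set of these tableaux. Weight: if $a_i$ (resp. $a_{\overline i}$) is the number of entries of $T$ equal to $i$ (resp. $\overline i$), then $\mathrm{wt}(T)=(\chi_1,\ldots,\chi_m)$ with $\chi_i=a_i-a_{\overline i}$. *)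

theory Defs
  imports "HOL-Algebra.Generated_Groups" "HOL-Algebra.Group_Action" "HOL-Computational_Algebra.Primes"
begin

section \<open>Partitions and skew shapes\<close>

text \<open>The part \<open>\<lambda>\<^sub>i\<close> is \<open>la (i - 1)\<close>: parts, rows and columns are indexed from \<open>0\<close>.\<close>

definition is_partition :: "(nat \<Rightarrow> nat) \<Rightarrow> bool" where
  "is_partition la \<longleftrightarrow> antimono la \<and> finite {i. la i \<noteq> 0}"

definition partition_length :: "(nat \<Rightarrow> nat) \<Rightarrow> nat" where
  "partition_length la = card {i. la i \<noteq> 0}"

definition partition_size :: "(nat \<Rightarrow> nat) \<Rightarrow> nat" where
  "partition_size la = (\<Sum>i | la i \<noteq> 0. la i)"

definition partition_contained :: "(nat \<Rightarrow> nat) \<Rightarrow> (nat \<Rightarrow> nat) \<Rightarrow> bool" where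
  "partition_contained mu la \<longleftrightarrow> (\<forall>i. mu i \<le> la i)"

definition skew_shape :: "(nat \<Rightarrow> nat) \<Rightarrow> (nat \<Rightarrow> nat) \<Rightarrow> (nat \<times> nat) set" where
  "skew_shape la mu = {(i, j). mu i \<le> j \<and> j < la i}"

section \<open>The alphabet\<close>

datatype letter = Unbarred nat | Barred nat

instantiation letter :: linorder
begin

fun less_eq_letter :: "letter \<Rightarrow> letter \<Rightarrow> bool" where
  "Unbarred i \<le> Unbarred j \<longleftrightarrow> i \<le> j"
| "Unbarred i \<le> Barred j \<longleftrightarrow> True"
| "Barred i \<le> Unbarred j \<longleftrightarrow> False"
| "Barred i \<le> Barred j \<longleftrightarrow> j \<le> i"

definition less_letter :: "letter \<Rightarrow> letter \<Rightarrow> bool" where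
  "x < y \<longleftrightarrow> x \<le> y \<and> \<not> y \<le> (x :: letter)"

instance
proof
  fix x y z :: letter
  show "x < y \<longleftrightarrow> x \<le> y \<and> \<not> y \<le> x" by (rule less_letter_def)
  show "x \<le> x" by (cases x) auto
  show "x \<le> y \<Longrightarrow> y \<le> z \<Longrightarrow> x \<le> z" by (cases x; cases y; cases z) auto
  show "x \<le> y \<Longrightarrow> y \<le> x \<Longrightarrow> x = y" by (cases x; cases y) auto
  show "x \<le> y \<or> y \<le> x" by (cases x; cases y) auto
qed

end

definition letters :: "nat \<Rightarrow> letter set" where
  "letters m = Unbarred ` {1..m} \<union> Barred ` {1..m}"

section \<open>Admissible columns and splitting\<close>

text \<open>A column is the list of its entries, read from top to bottom.\<close>

definition is_column :: "nat \<Rightarrow> letter list \<Rightarrow> bool" where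
  "is_column m C \<longleftrightarrow> set C \<subseteq> letters m \<and> sorted_wrt (<) C"

text \<open>The list \<open>[z\<^sub>1, \<dots>, z\<^sub>r]\<close>, in decreasing order.\<close>

definition paired_letters :: "letter list \<Rightarrow> nat list" where
  "paired_letters C = rev (sorted_list_of_set {z. Unbarred z \<in> set C \<and> Barred z \<in> set C})"

definition free_letters_below :: "nat \<Rightarrow> letter list \<Rightarrow> nat \<Rightarrow> nat set" where
  "free_letters_below m C b =
     {t \<in> {1..m}. t < b \<and> Unbarred t \<notin> set C \<and> Barred t \<notin> set C}"

text \<open>\<open>ts\<close> is the list \<open>[t\<^sub>1, \<dots>, t\<^sub>r]\<close>. The emptiness condition is needed because \<open>Max {}\<close> is
  unspecified.\<close>

definition is_splitting :: "nat \<Rightarrow> letter list \<Rightarrow> nat list \<Rightarrow> bool" where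
  "is_splitting m C ts \<longleftrightarrow>
     (let zs = paired_letters C in
        length ts = length zs \<and>
        (\<forall>i < length zs.
           let F = free_letters_below m C (if i = 0 then zs ! 0 else min (ts ! (i - 1)) (zs ! i))
           in F \<noteq> {} \<and> ts ! i = Max F))"

definition admissible :: "nat \<Rightarrow> letter list \<Rightarrow> bool" where
  "admissible m C \<longleftrightarrow> is_column m C \<and> (\<exists>ts. is_splitting m C ts)"

lemma is_splitting_unique:
  assumes "is_splitting m C ts" "is_splitting m C us"
  shows "ts = us"
proof (rule nth_equalityI)
  define z where "z = paired_letters C"
  define bd where "bd = (\<lambda>(vs :: nat list) i. if i = 0 then z ! 0 else min (vs ! (i - 1)) (z ! i))"
  have len_split: "length vs = length z"
    and nth_split: "i < length z \<Longrightarrow> vs ! i = Max (free_letters_below m C (bd vs i))"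
    if "is_splitting m C vs" for vs i
    using that unfolding is_splitting_def Let_def z_def bd_def by blast+
  show "length ts = length us"
    using len_split[OF assms(1)] len_split[OF assms(2)] by simp
  fix i assume "i < length ts"
  then show "ts ! i = us ! i"
  proof (induction i)
    case 0
    have "bd ts 0 = bd us 0" by (simp add: bd_def)
    then show ?case
      using 0 nth_split[OF assms(1), of 0] nth_split[OF assms(2), of 0] len_split[OF assms(1)] by metis
  next
    case (Suc i)
    then have "bd ts (Suc i) = bd us (Suc i)" by (simp add: bd_def)
    then show ?case
      using Suc.prems nth_split[OF assms(1), of "Suc i"] nth_split[OF assms(2), of "Suc i"]
        len_split[OF assms(1)] by metis
  qed
qed

definition splitting :: "nat \<Rightarrow> letter list \<Rightarrow> nat list" where
  "splitting m C = (THE ts. is_splitting m C ts)"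

text \<open>The entries of a column are distinct, so replacing letters and reordering amounts to
  exchanging elements of its set of entries.\<close>

definition right_column :: "nat \<Rightarrow> letter list \<Rightarrow> letter list" where
  "right_column m C = sorted_list_of_set
     ((set C - Barred ` set (paired_letters C)) \<union> Barred ` set (splitting m C))"

definition left_column :: "nat \<Rightarrow> letter list \<Rightarrow> letter list" where
  "left_column m C = sorted_list_of_set
     ((set C - Unbarred ` set (paired_letters C)) \<union> Unbarred ` set (splitting m C))"

section \<open>Kashiwara--Nakashima skew tableaux\<close>

text \<open>The box \<open>(i, j)\<close> lies in row \<open>i\<close> and column \<open>j\<close>.\<close>

definition semistandard :: "(nat \<times> nat) set \<Rightarrow> (nat \<times> nat \<Rightarrow> letter) \<Rightarrow> bool" where
  "semistandard S T \<longleftrightarrow>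
     (\<forall>i j j'. (i, j) \<in> S \<and> (i, j') \<in> S \<and> j \<le> j' \<longrightarrow> T (i, j) \<le> T (i, j')) \<and>
     (\<forall>i i' j. (i, j) \<in> S \<and> (i', j) \<in> S \<and> i < i' \<longrightarrow> T (i, j) < T (i', j))"

definition column_rows :: "(nat \<times> nat) set \<Rightarrow> nat \<Rightarrow> nat set" where
  "column_rows S j = {i. (i, j) \<in> S}"

definition tableau_column :: "(nat \<times> nat) set \<Rightarrow> (nat \<times> nat \<Rightarrow> letter) \<Rightarrow> nat \<Rightarrow> letter list" where
  "tableau_column S T j = map (\<lambda>i. T (i, j)) (sorted_list_of_set (column_rows S j))"

text \<open>Doubling columns turns the shape \<open>\<lambda>/\<mu>\<close> into \<open>2\<lambda>/2\<mu>\<close>. The columns \<open>2j\<close> and \<open>2j + 1\<close> of the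
  split form are \<open>\<ell>C\<close> and \<open>rC\<close>, for \<open>C\<close> the column \<open>j\<close> of \<open>T\<close>; they start in the top row of \<open>C\<close>,
  and the rows of a column of a skew shape are consecutive.\<close>

definition split_shape :: "(nat \<Rightarrow> nat) \<Rightarrow> (nat \<Rightarrow> nat) \<Rightarrow> (nat \<times> nat) set" where
  "split_shape la mu = skew_shape (\<lambda>i. 2 * la i) (\<lambda>i. 2 * mu i)"

definition split_form ::
  "nat \<Rightarrow> (nat \<times> nat) set \<Rightarrow> (nat \<times> nat \<Rightarrow> letter) \<Rightarrow> nat \<times> nat \<Rightarrow> letter" where
  "split_form m S T = (\<lambda>(i, k).
     let j = k div 2;
         C = tableau_column S T j;
         D = (if even k then left_column m C else right_column m C)
     in D ! (i - Min (column_rows S j)))"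

text \<open>Fillings are extensional functions on the shape (undefined outside it), so that distinct
  elements of \<open>SP\<close> are distinct tableaux.\<close>

definition SP :: "nat \<Rightarrow> (nat \<Rightarrow> nat) \<Rightarrow> (nat \<Rightarrow> nat) \<Rightarrow> (nat \<times> nat \<Rightarrow> letter) set" where
  "SP m la mu =
     {T \<in> skew_shape la mu \<rightarrow>\<^sub>E letters m.
        semistandard (skew_shape la mu) T \<and>
        (\<forall>j. admissible m (tableau_column (skew_shape la mu) T j)) \<and>
        semistandard (split_shape la mu) (split_form m (skew_shape la mu) T)}"

definition entry_count :: "(nat \<times> nat) set \<Rightarrow> (nat \<times> nat \<Rightarrow> letter) \<Rightarrow> letter \<Rightarrow> nat" where
  "entry_count S T x = card {b \<in> S. T b = x}"

text \<open>The list \<open>[\<chi>\<^sub>1, \<dots>, \<chi>\<^sub>m]\<close>.\<close>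

definition weight :: "nat \<Rightarrow> (nat \<times> nat) set \<Rightarrow> (nat \<times> nat \<Rightarrow> letter) \<Rightarrow> int list" where
  "weight m S T =
     map (\<lambda>i. int (entry_count S T (Unbarred i)) - int (entry_count S T (Barred i))) [1..<Suc m]"

end

theory Submission
  imports Defs
begin

text \<open>
  The generator acts on weights by the signed cyclic shift \<open>\<sigma>\<close>, which satisfies \<open>\<sigma>\<^sup>m = -1\<close>. A
  weight \<open>\<chi>\<close> is therefore recorded as a function on \<open>\<nat>\<close> with \<open>f (x + m) = - f x\<close>, and \<open>\<sigma>\<close> becomes
  translation by one. If an orbit has fewer than \<open>2 m\<close> elements, some \<open>g\<^sup>k\<close> with \<open>0 < k < 2 m\<close>
  fixes a tableau, so that \<open>f\<close> has period \<open>k\<close>, hence period \<open>d = gcd k (2 m)\<close>. Since \<open>n\<close> is odd and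
  \<open>\<chi>\<^sub>1 + \<dots> + \<chi>\<^sub>m \<equiv> n\<close> modulo \<open>2\<close>, the function \<open>f\<close> is not zero, so \<open>d\<close> does not divide \<open>m\<close> and
  \<open>q = 2 m / d\<close> is odd. Translating a nonzero value of \<open>f\<close> by multiples of \<open>d\<close> reaches \<open>q\<close> different
  residues modulo \<open>m\<close>, whence \<open>q \<le> \<bar>\<chi>\<^sub>1\<bar> + \<dots> + \<bar>\<chi>\<^sub>m\<bar> \<le> n\<close>
  (lemma \<open>antiperiodic_odd_divisor\<close>). As \<open>q\<close> divides \<open>m\<close> and \<open>q > 1\<close>, every prime factor of \<open>q\<close> is an
  odd prime that is at most \<open>n\<close> and divides \<open>m\<close>, against the hypothesis.
\<close>

section \<open>Antiperiodic functions\<close>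

text \<open>The bound on \<open>q\<close> counts nonzero values in a window of length \<open>m\<close>, each of absolute value at
  least \<open>1\<close>.\<close>

lemma antiperiodic_odd_divisor:
  fixes f :: "nat \<Rightarrow> int"
  assumes "m > 0"
    and anti: "\<And>x. f (x + m) = - f x"
    and period: "\<And>x. f (x + k) = f x"
    and nondvd: "\<not> 2 * m dvd k"
    and nonzero: "f a \<noteq> 0"
  shows "\<exists>q > 1. odd q \<and> q dvd m \<and> int q \<le> (\<Sum>i<m. \<bar>f i\<bar>)"
proof -
  define d where "d = gcd (2 * m) k"
  have mult: "f (x + c * y) = f x" if "\<And>x. f (x + c) = f x" for c x y
  proof (induction y)
    case (Suc y)
    then show ?case using that[of "x + c * y"] by (simp add: algebra_simps)
  qed simp
  have per2: "f (x + 2 * m) = f x" for x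
    using anti[of x] anti[of "x + m"] by (simp add: mult_2 add.assoc)
  have perd: "f (x + d) = f x" for x
  proof (cases "k = 0")
    case True
    with nondvd show ?thesis by simp
  next
    case False
    then obtain u v where uv: "k * u = 2 * m * v + d"
      using bezout_nat[of k "2 * m"] by (auto simp: d_def gcd.commute)
    have "f (x + d) = f (x + d + 2 * m * v)"
      using mult[OF per2] by simp
    also have "\<dots> = f (x + k * u)"
      by (simp only: uv) (simp add: ac_simps)
    also have "\<dots> = f x"
      using mult[OF period] .
    finally show ?thesis .
  qed
  obtain q where q: "2 * m = d * q"
    unfolding d_def by (meson dvdE gcd_dvd1)
  have "d \<noteq> 2 * m"
    using nondvd unfolding d_def by (metis gcd_dvd2)
  then have "q > 1"
    using q \<open>m > 0\<close> by (cases "q = 0 \<or> q = 1") auto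
  \<comment> \<open>Otherwise \<open>d\<close> divides \<open>m\<close>, so that translation by \<open>m\<close> both fixes and negates \<open>f a\<close>.\<close>
  have "odd q"
  proof
    assume "even q"
    then obtain r where "q = 2 * r" ..
    then have "m = d * r"
      using q by simp
    then show False
      using mult[OF perd, of a r] anti[of a] nonzero by simp
  qed
  then obtain e where e: "d = 2 * e"
    using q by (metis dvd_triv_left even_mult_iff evenE)
  then have m: "m = e * q"
    using q by simp
  \<comment> \<open>The residues modulo \<open>m = e q\<close> of \<open>a, a + 2 e, \<dots>, a + 2 e (q - 1)\<close> are distinct because \<open>q\<close>
    is odd, and \<open>f\<close> does not vanish at any of them.\<close>
  define pos where "pos = (\<lambda>j. (a + d * j) mod m)"
  have abs_mod: "\<bar>f (x mod m)\<bar> = \<bar>f x\<bar>" for x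
  proof -
    have "\<bar>f (y + m * z)\<bar> = \<bar>f y\<bar>" for y z
    proof (induction z)
      case (Suc z)
      then show ?case using anti[of "y + m * z"] by (simp add: algebra_simps)
    qed simp
    from this[of "x mod m" "x div m"] show ?thesis by simp
  qed
  have "inj_on pos {..<q}"
  proof (rule linorder_inj_onI)
    fix i j assume ij: "i < j" "i \<in> {..<q}" "j \<in> {..<q}"
    show "pos i \<noteq> pos j"
    proof
      assume "pos i = pos j"
      then have "m dvd (a + d * j) - (a + d * i)"
        unfolding pos_def using ij(1) by (intro mod_eq_dvd_iff_nat[THEN iffD1]) simp_all
      also have "(a + d * j) - (a + d * i) = e * (2 * (j - i))"
        using e by (simp add: diff_mult_distrib2)
      finally have "q dvd 2 * (j - i)"
        using m \<open>m > 0\<close> by simp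
      then have "q dvd j - i"
        using \<open>odd q\<close> by (simp add: coprime_dvd_mult_right_iff)
      then show False
        using ij by (auto dest: dvd_imp_le)
    qed
  qed auto
  moreover have "pos ` {..<q} \<subseteq> {i \<in> {..<m}. f i \<noteq> 0}"
    using abs_mod mult[OF perd, of a] nonzero \<open>m > 0\<close> unfolding pos_def
    by (smt (verit) image_subsetI lessThan_iff mem_Collect_eq mod_less_divisor)
  ultimately have "q \<le> card {i \<in> {..<m}. f i \<noteq> 0}"
    using card_inj_on_le[of pos "{..<q}" "{i \<in> {..<m}. f i \<noteq> 0}"] by simp
  also have "int (card {i \<in> {..<m}. f i \<noteq> 0}) = (\<Sum>i \<in> {i \<in> {..<m}. f i \<noteq> 0}. 1)"
    by simp
  also have "\<dots> \<le> (\<Sum>i \<in> {i \<in> {..<m}. f i \<noteq> 0}. \<bar>f i\<bar>)"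
    by (rule sum_mono) auto
  also have "\<dots> \<le> (\<Sum>i<m. \<bar>f i\<bar>)"
    by (rule sum_mono2) auto
  finally show ?thesis
    using \<open>q > 1\<close> \<open>odd q\<close> m by auto
qed

section \<open>The signed cyclic shift\<close>

text \<open>The signed cyclic shift \<open>(w\<^sub>1, \<dots>, w\<^sub>m) \<mapsto> (- w\<^sub>m, w\<^sub>1, \<dots>, w\<^bsub>m-1\<^esub>)\<close>.\<close>

definition signed_shift :: "int list \<Rightarrow> int list" where
  "signed_shift w = - last w # butlast w"

text \<open>The extension of a list of length \<open>m\<close>, indexed from \<open>0\<close>, to a function on \<open>\<nat>\<close> that changes
  sign under translation by \<open>m\<close>.\<close>

definition signed_extension :: "int list \<Rightarrow> nat \<Rightarrow> int" where
  "signed_extension w x = (-1) ^ (x div length w) * w ! (x mod length w)"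

lemma signed_extension_antiperiodic:
  "w \<noteq> [] \<Longrightarrow> signed_extension w (x + length w) = - signed_extension w x"
  by (simp add: signed_extension_def div_add_self2)

lemma length_signed_shift: "w \<noteq> [] \<Longrightarrow> length (signed_shift w) = length w"
  by (simp add: signed_shift_def)

lemma signed_extension_shift:
  assumes "w \<noteq> []"
  shows "signed_extension (signed_shift w) (Suc x) = signed_extension w x"
proof (cases "Suc (x mod length w) = length w")
  case True
  then have "Suc x mod length w = 0" "Suc x div length w = Suc (x div length w)"
    by (auto simp: mod_Suc div_Suc)
  moreover have "x mod length w = length w - 1"
    using True by simp
  ultimately show ?thesis
    using assms by (simp add: signed_extension_def length_signed_shift)
      (simp add: signed_shift_def last_conv_nth)
next
  case False
  have "x mod length w < length w"
    using assms by simp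
  with False have "x mod length w < length w - 1"
    by simp
  moreover have "Suc x mod length w = Suc (x mod length w)" "Suc x div length w = x div length w"
    using False by (auto simp: mod_Suc div_Suc)
  ultimately show ?thesis
    using assms by (simp add: signed_extension_def length_signed_shift)
      (simp add: signed_shift_def nth_butlast)
qed

lemma signed_extension_funpow_shift:
  assumes "w \<noteq> []"
  shows "signed_extension ((signed_shift ^^ k) w) (x + k) = signed_extension w x"
proof -
  have "(signed_shift ^^ k) w \<noteq> []" for k
    by (cases k) (use assms in \<open>auto simp: signed_shift_def\<close>)
  then show ?thesis
    by (induction k) (simp_all add: signed_extension_shift)
qed

section \<open>The weight of a filling\<close>

lemma card_skew_shape:
  assumes "is_partition la" "partition_contained mu la"
  shows "finite (skew_shape la mu)"
    and "card (skew_shape la mu) = partition_size la - partition_size mu"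
proof -
  let ?I = "{i. la i \<noteq> 0}"
  have fin: "finite ?I"
    using assms(1) by (simp add: is_partition_def)
  have le: "mu i \<le> la i" for i
    using assms(2) by (simp add: partition_contained_def)
  have eq: "skew_shape la mu = Sigma ?I (\<lambda>i. {mu i..<la i})"
    by (auto simp: skew_shape_def)
  show "finite (skew_shape la mu)"
    unfolding eq using fin by auto
  have "{i. mu i \<noteq> 0} \<subseteq> ?I"
    using le by (metis (mono_tags, lifting) Collect_mono le_zero_eq)
  then have "partition_size mu = sum mu ?I"
    unfolding partition_size_def using fin by (intro sum.mono_neutral_left) auto
  then show "card (skew_shape la mu) = partition_size la - partition_size mu"
    unfolding eq partition_size_def using fin le by (simp add: sum_subtractf_nat)
qed

lemma sum_entry_count:
  assumes "finite S" "T ` S \<subseteq> letters m"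
  shows "(\<Sum>i = 1..m. entry_count S T (Unbarred i) + entry_count S T (Barred i)) = card S"
proof -
  have "card S = (\<Sum>x \<in> letters m. entry_count S T x)"
    using sum.group[of S "letters m" T "\<lambda>_. 1 :: nat"] assms
    by (simp add: entry_count_def letters_def)
  also have "\<dots> = (\<Sum>x \<in> Unbarred ` {1..m}. entry_count S T x)
      + (\<Sum>x \<in> Barred ` {1..m}. entry_count S T x)"
    unfolding letters_def by (rule sum.union_disjoint) auto
  finally show ?thesis
    by (simp add: sum.reindex inj_on_def sum.distrib)
qed

lemma length_weight: "length (weight m S T) = m"
  by (simp add: weight_def)

lemma sum_weight:
  "(\<Sum>i<m. h (weight m S T ! i)) =
     (\<Sum>i = 1..m. h (int (entry_count S T (Unbarred i)) - int (entry_count S T (Barred i))))"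
  by (rule sum.reindex_bij_witness[of _ "\<lambda>i. i - 1" Suc])
    (auto simp: weight_def simp del: upt_Suc)

lemma sum_abs_weight_le:
  assumes "finite S" "T ` S \<subseteq> letters m"
  shows "(\<Sum>i<m. \<bar>weight m S T ! i\<bar>) \<le> int (card S)"
  unfolding sum_weight[of abs] sum_entry_count[OF assms, symmetric] of_nat_sum
  by (rule sum_mono) simp

lemma even_sum_weight_iff:
  assumes "finite S" "T ` S \<subseteq> letters m"
  shows "even (\<Sum>i<m. weight m S T ! i) \<longleftrightarrow> even (card S)"
proof -
  have "int (card S) - (\<Sum>i<m. weight m S T ! i)
      = 2 * (\<Sum>i = 1..m. int (entry_count S T (Barred i)))"
    unfolding sum_weight[of "\<lambda>x. x"] sum_entry_count[OF assms, symmetric]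
    by (simp add: sum.distrib sum_subtractf)
  then show ?thesis
    by presburger
qed

section \<open>Orbits of the cyclic action\<close>

theorem theorem5p1:
  fixes m n :: nat
    and la mu :: "nat \<Rightarrow> nat"
    and G :: "('g, 'x) monoid_scheme"
    and g :: 'g
    and act :: "'g \<Rightarrow> (nat \<times> nat \<Rightarrow> letter) \<Rightarrow> (nat \<times> nat \<Rightarrow> letter)"
  assumes "m > 0"
    and "is_partition la" and "is_partition mu" and "partition_contained mu la"
    and "partition_length la \<le> m"
    and "partition_size la - partition_size mu = n" and "odd n"
    and "\<And>p :: nat. Factorial_Ring.prime p \<Longrightarrow> odd p \<Longrightarrow> p \<le> n \<Longrightarrow> gcd m p = 1"
    and "group G" and "g \<in> carrier G" and "carrier G = generate G {g}" and "order G = 2 * m"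
    and "group_action G (SP m la mu) act"
    and "\<And>T. T \<in> SP m la mu \<Longrightarrow>
           weight m (skew_shape la mu) (act g T) =
             - last (weight m (skew_shape la mu) T) # butlast (weight m (skew_shape la mu) T)"
  shows "\<forall>orb \<in> orbits G (SP m la mu) act. card orb = 2 * m"
proof
  interpret group_action G "SP m la mu" act by fact
  let ?S = "skew_shape la mu"
  fix orb assume "orb \<in> orbits G (SP m la mu) act"
  then obtain T where T: "T \<in> SP m la mu" and orb: "orb = (\<lambda>h. act h T) ` carrier G"
    by (auto simp: orbits_def orbit_def)
  have G: "group G" by fact
  have g: "g \<in> carrier G" by fact
  have pow_closed: "g [^]\<^bsub>G\<^esub> k \<in> carrier G" for k :: nat
    using G g by (simp add: group.is_monoid monoid.nat_pow_closed)
  have fin: "finite ?S" and card: "card ?S = n"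
    using card_skew_shape[of la mu] assms(2,4,6) by auto
  have img: "T ` ?S \<subseteq> letters m"
    using T by (auto simp: SP_def)
  define w where "w = weight m ?S T"
  have w: "w \<noteq> []" "length w = m"
    using \<open>m > 0\<close> length_weight[of m ?S T] by (auto simp: w_def)
  have shift: "weight m ?S (act (g [^]\<^bsub>G\<^esub> k) T) = (signed_shift ^^ k) w" for k :: nat
  proof (induction k)
    case 0
    then show ?case
      using T by (simp add: w_def id_eq_one[symmetric])
  next
    case (Suc k)
    have "act (g [^]\<^bsub>G\<^esub> Suc k) T = act g (act (g [^]\<^bsub>G\<^esub> k) T)"
      using monoid.nat_pow_Suc2[OF group.is_monoid[OF G] g] composition_rule[OF T g pow_closed] by simp
    moreover have "act (g [^]\<^bsub>G\<^esub> k) T \<in> SP m la mu"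
      using element_image[OF pow_closed T refl] .
    ultimately show ?case
      using Suc assms(14) by (simp add: signed_shift_def)
  qed
  have no_period: False if fixed: "act (g [^]\<^bsub>G\<^esub> k) T = T" and k: "0 < k" "k < 2 * m" for k :: nat
  proof -
    let ?f = "signed_extension w"
    have f: "?f i = w ! i" if "i < m" for i
      using that w by (simp add: signed_extension_def)
    have "(\<Sum>i<m. w ! i) \<noteq> 0"
      using even_sum_weight_iff[OF fin img] card \<open>odd n\<close> by (auto simp: w_def)
    then obtain a where "a < m" "w ! a \<noteq> 0"
      by (meson lessThan_iff sum.neutral)
    then have "?f a \<noteq> 0"
      using f by simp
    moreover have "?f (x + k) = ?f x" for x
      using signed_extension_funpow_shift[OF w(1), of k x] shift[of k] fixed by (simp add: w_def)
    moreover have "\<not> 2 * m dvd k"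
      using k by (auto dest: dvd_imp_le)
    ultimately obtain q where q: "q > 1" "odd q" "q dvd m" "int q \<le> (\<Sum>i<m. \<bar>?f i\<bar>)"
      using antiperiodic_odd_divisor[of m ?f k a] signed_extension_antiperiodic[OF w(1)] w(2)
        \<open>m > 0\<close> by metis
    have "(\<Sum>i<m. \<bar>?f i\<bar>) = (\<Sum>i<m. \<bar>w ! i\<bar>)"
      by (rule sum.cong) (auto simp: f)
    with q(4) have "q \<le> n"
      using sum_abs_weight_le[OF fin img] card by (simp add: w_def)
    obtain p where p: "Factorial_Ring.prime p" "p dvd q"
      using q(1) prime_factor_nat[of q] by auto
    have "odd p"
      using p(2) q(2) dvd_trans by blast
    moreover have "p \<le> n"
      using dvd_imp_le[OF p(2)] q(1) \<open>q \<le> n\<close> by simp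
    ultimately have "gcd m p = 1"
      using assms(8) p(1) by blast
    moreover have "p dvd gcd m p"
      using dvd_trans[OF p(2) q(3)] by simp
    ultimately show False
      using p(1) by simp
  qed
  \<comment> \<open>An orbit contains the \<open>2 m\<close> distinct tableaux \<open>g\<^sup>k T\<close> with \<open>k < 2 m\<close>, and it has at most as
    many elements as the group.\<close>
  have inj: "inj_on (\<lambda>k :: nat. act (g [^]\<^bsub>G\<^esub> k) T) {..<2 * m}"
  proof (rule linorder_inj_onI)
    fix i j :: nat assume ij: "i < j" "i \<in> {..<2 * m}" "j \<in> {..<2 * m}"
    show "act (g [^]\<^bsub>G\<^esub> i) T \<noteq> act (g [^]\<^bsub>G\<^esub> j) T"
    proof
      assume eq: "act (g [^]\<^bsub>G\<^esub> i) T = act (g [^]\<^bsub>G\<^esub> j) T"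
      let ?U = "act (g [^]\<^bsub>G\<^esub> (j - i)) T"
      have U: "?U \<in> SP m la mu"
        using element_image[OF pow_closed T refl] .
      have "g [^]\<^bsub>G\<^esub> j = g [^]\<^bsub>G\<^esub> i \<otimes>\<^bsub>G\<^esub> g [^]\<^bsub>G\<^esub> (j - i)"
        using ij(1) G g by (simp add: group.is_monoid monoid.nat_pow_mult)
      then have "act (g [^]\<^bsub>G\<^esub> i) T = act (g [^]\<^bsub>G\<^esub> i) ?U"
        using eq composition_rule[OF T pow_closed pow_closed] by simp
      then have "?U = T"
        using inj_onD[OF inj_prop[OF pow_closed]] T U by metis
      then show False
        using no_period[of "j - i"] ij less_imp_diff_less[of j "2 * m" i] by simp
    qed
  qed auto
  have "finite (carrier G)"
    using \<open>order G = 2 * m\<close> \<open>m > 0\<close>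
    by (intro card_ge_0_finite) (simp add: order_def)
  then have "card orb \<le> 2 * m" "finite orb"
    using \<open>order G = 2 * m\<close> card_image_le[of "carrier G" "\<lambda>h. act h T"] by (auto simp: orb order_def)
  moreover have "2 * m \<le> card orb"
    using card_inj_on_le[OF inj _ \<open>finite orb\<close>] pow_closed by (auto simp: orb)
  ultimately show "card orb = 2 * m"
    by simp
qed

end
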